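(* Let $\mathbb{E}$ be a one-face embedding of a graph $G$, and let $v$ be a vertex of $G$ with $deg(v)\ge 4$. Then there is at least one other way to arrange the half edges around the vertex $v$ (i.e. a cyclic order on the half edges at $v$ different from the one in $\mathbb{E}$) such that the obtained embedding $\mathbb{E}'$ has the same genus as $\mathbb{E}$.
   Context: Graphs are finite and connected with at least one edge, loops and multiple edges allowed. An embedding is a 2-cell embedding on a closed orientable surface. Permutations are composed right to left. An embedding $\mathbb{E}$ of $G$ with $e$ edges is encoded by a triple $(\alpha,\beta,\gamma)$ of permutations of the set $[2e]$ of half edges (each edge consists of two half edges): $\alpha$ is the fixed-point-free involution pairing the two half edges of each edge; the cycles of $\beta$ are the vertices, each cycle listing the half edges incident to that vertex in counterclockwise cyclic order; $\gamma=\alpha\beta$, and its cycles (fixed points included) are the faces. One-face means $\gamma$ is a single cycle. The genus $g$ is given by $(\#\text{vertices})-(\#\text{edges})+(\#\text{faces})=2-2g$. The degree $deg(v)$ is the number of half edges incident to $v$. Rearranging the half edges around $v$ according to a cyclic order $\theta$ on the half edges at $v$ means replacing the cycle of $\beta$ corresponding to $v$ by $\theta$, keeping $\alpha$ and all other cycles of $\beta$. *)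

theory Defs
  imports Complex_Main "HOL-Library.Disjoint_Sets" "HOL-Combinatorics.Permutations" "HOL-Combinatorics.Orbits"
begin

definition half_edges :: "nat \<Rightarrow> nat set" where
  "half_edges e = {1..2 * e}"

text \<open>The cycles of a permutation of \<open>H\<close> (fixed points included), each identified with the set of
  elements it moves through.\<close>

definition cycles :: "('a \<Rightarrow> 'a) \<Rightarrow> 'a set \<Rightarrow> 'a set set" where
  "cycles p H = orbit p ` H"

text \<open>A multigraph is given by its half edges: the involution \<open>pairing\<close> joins two half edges into
  an edge, and a vertex is the set of half edges incident to it.  Since graphs are connected with at
  least one edge, every vertex has an incident half edge, so no graph is lost.  Loops occur
  as edges with both half edges in the same vertex.\<close>

record hgraph =
  graph_edges :: nat
  pairing :: "nat \<Rightarrow> nat"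
  vertices :: "nat set set"

definition adjacency :: "hgraph \<Rightarrow> (nat set \<times> nat set) set" where
  "adjacency G = {(u, w). u \<in> vertices G \<and> w \<in> vertices G \<and> (\<exists>h\<in>u. pairing G h \<in> w)}"

definition fpf_involution :: "('a \<Rightarrow> 'a) \<Rightarrow> 'a set \<Rightarrow> bool" where
  "fpf_involution p H \<longleftrightarrow> p permutes H \<and> (\<forall>h\<in>H. p h \<noteq> h \<and> p (p h) = h)"

definition is_graph :: "hgraph \<Rightarrow> bool" where
  "is_graph G \<longleftrightarrow>
     graph_edges G \<ge> 1 \<and>
     fpf_involution (pairing G) (half_edges (graph_edges G)) \<and>
     partition_on (half_edges (graph_edges G)) (vertices G) \<and>
     (\<forall>u\<in>vertices G. \<forall>w\<in>vertices G. (u, w) \<in> (adjacency G)\<^sup>*)"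

definition deg :: "nat set \<Rightarrow> nat" where
  "deg v = card v"

record embedding =
  num_edges :: nat
  alpha :: "nat \<Rightarrow> nat"
  beta :: "nat \<Rightarrow> nat"
  gamma :: "nat \<Rightarrow> nat"

definition is_embedding :: "hgraph \<Rightarrow> embedding \<Rightarrow> bool" where
  "is_embedding G E \<longleftrightarrow>
     num_edges E = graph_edges G \<and>
     alpha E = pairing G \<and>
     beta E permutes half_edges (num_edges E) \<and>
     cycles (beta E) (half_edges (num_edges E)) = vertices G \<and>
     gamma E = alpha E \<circ> beta E"

definition one_face :: "embedding \<Rightarrow> bool" where
  "one_face E \<longleftrightarrow> cyclic_on (gamma E) (half_edges (num_edges E))"

definition num_vertices :: "embedding \<Rightarrow> nat" where
  "num_vertices E = card (cycles (beta E) (half_edges (num_edges E)))"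

definition num_faces :: "embedding \<Rightarrow> nat" where
  "num_faces E = card (cycles (gamma E) (half_edges (num_edges E)))"

text \<open>The solution \<open>g\<close> of \<open>V - E + F = 2 - 2 g\<close>.  It is taken in the rationals so that the division
  is exact, with no rounding and no truncated subtraction.\<close>

definition genus :: "embedding \<Rightarrow> rat" where
  "genus E = (2 - (of_nat (num_vertices E) - of_nat (num_edges E) + of_nat (num_faces E))) / 2"

text \<open>A cyclic order on \<open>S\<close>, given by its successor function (the identity outside \<open>S\<close>).\<close>

definition cyclic_order_on :: "'a set \<Rightarrow> ('a \<Rightarrow> 'a) \<Rightarrow> bool" where
  "cyclic_order_on S \<theta> \<longleftrightarrow> \<theta> permutes S \<and> cyclic_on \<theta> S"

definition order_at :: "embedding \<Rightarrow> nat set \<Rightarrow> nat \<Rightarrow> nat" where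
  "order_at E v = perm_restrict (beta E) v"

definition replace_cycle :: "('a \<Rightarrow> 'a) \<Rightarrow> 'a set \<Rightarrow> ('a \<Rightarrow> 'a) \<Rightarrow> 'a \<Rightarrow> 'a" where
  "replace_cycle p v \<theta> = (\<lambda>h. if h \<in> v then \<theta> h else p h)"

definition rearrange :: "embedding \<Rightarrow> nat set \<Rightarrow> (nat \<Rightarrow> nat) \<Rightarrow> embedding" where
  "rearrange E v \<theta> =
     E\<lparr>beta := replace_cycle (beta E) v \<theta>, gamma := alpha E \<circ> replace_cycle (beta E) v \<theta>\<rparr>"

end

theory Submission
  imports Defs
begin

text \<open>Keeping the graph keeps the numbers of vertices and edges, so an embedding of the same genus
  is one that again has a single face: with \<open>\<sigma>\<close> the cyclic order at \<open>v\<close> and \<open>\<gamma>\<close> the face permutation,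
  what is needed is a nontrivial permutation \<open>\<pi>\<close> of \<open>v\<close> such that both \<open>\<sigma> \<circ> \<pi>\<close> (on \<open>v\<close>) and
  \<open>\<gamma> \<circ> \<pi>\<close> (on all half edges) are single cycles; the new order is then \<open>\<sigma> \<circ> \<pi>\<close>.

  Two kinds of \<open>\<pi>\<close> turn a single cycle into a single cycle.  A 3-cycle does so if its three points
  are traversed in the order in which the big cycle meets them (\<open>cyclic_on_compose_3_cycle\<close>), and a
  product of two transpositions does so if the two transposed pairs cross on the big cycle
  (\<open>cyclic_on_compose_crossing_transpositions\<close>).  The second condition does not
  change when the direction of the cycle is reversed.

  Now take four consecutive half edges \<open>a\<close>, \<open>b\<close>, \<open>c\<close>, \<open>d\<close> around \<open>v\<close>.  If the face, starting
  from \<open>a\<close>, meets two of \<open>b\<close>, \<open>c\<close>, \<open>d\<close> in the order in which the vertex does, these two and \<open>a\<close>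
  give a 3-cycle that suits both \<open>\<sigma>\<close> and \<open>\<gamma>\<close>.  Otherwise the face meets them as \<open>d\<close>, \<open>c\<close>, \<open>b\<close>, and
  the pairs \<open>{a, c}\<close> and \<open>{b, d}\<close> cross on both cycles.\<close>

section \<open>Travelling along a cycle\<close>

text \<open>On a cycle through \<open>a\<close>, the number \<open>funpow_dist p a x\<close> is the time at which a walk from \<open>a\<close>
  first reaches \<open>x\<close>, and \<open>funpow_dist1 p a a\<close> is the length of the cycle.\<close>

lemma cyclic_on_eq_funpow_image:
  assumes "cyclic_on p S" "a \<in> S"
  shows "S = (\<lambda>t. (p ^^ t) a) ` {0..<funpow_dist1 p a a}"
  using assms orbit_conv_funpow_dist1[of a p] orbit_cyclic_eq3[OF assms] by simp

lemma cyclic_on_funpow_dist: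
  assumes "cyclic_on p S" "a \<in> S" "x \<in> S"
  shows "(p ^^ funpow_dist p a x) a = x"
  using assms orbit_cyclic_eq3 funpow_dist_prop by metis

lemma cyclic_on_funpow_dist_less:
  assumes "cyclic_on p S" "a \<in> S" "x \<in> S"
  shows "funpow_dist p a x < funpow_dist1 p a a"
proof -
  obtain t where t: "t < funpow_dist1 p a a" "x = (p ^^ t) a"
    using cyclic_on_eq_funpow_image[OF assms(1,2)] assms(3) by auto
  then have "funpow_dist p a x \<le> t"
    using funpow_dist_least[of t p a x] by (metis not_le)
  with t(1) show ?thesis by (rule order.strict_trans1[rotated])
qed

lemma cyclic_on_funpow_dist_funpow:
  assumes "cyclic_on p S" "a \<in> S" "t < funpow_dist1 p a a"
  shows "funpow_dist p a ((p ^^ t) a) = t"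
proof -
  have x: "(p ^^ t) a \<in> S"
    using assms by (simp add: cyclic_on_funpow_in)
  have "a \<in> orbit p a"
    using assms(2) orbit_cyclic_eq3[OF assms(1,2)] by simp
  then have "inj_on (\<lambda>n. (p ^^ n) a) {0..<funpow_dist1 p a a}"
    by (rule inj_on_funpow_dist1)
  then show ?thesis
    using cyclic_on_funpow_dist[OF assms(1,2) x] cyclic_on_funpow_dist_less[OF assms(1,2) x] assms(3)
    by (auto dest!: inj_onD)
qed

lemma cyclic_on_funpow_dist_eq_0_iff:
  assumes "cyclic_on p S" "a \<in> S" "x \<in> S"
  shows "funpow_dist p a x = 0 \<longleftrightarrow> x = a"
  using assms orbit_cyclic_eq3 funpow_dist_0_eq by metis

lemma cyclic_on_funpow_dist_inject:
  assumes "cyclic_on p S" "a \<in> S" "x \<in> S" "y \<in> S"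
  shows "funpow_dist p a x = funpow_dist p a y \<longleftrightarrow> x = y"
  using assms cyclic_on_funpow_dist by metis

text \<open>A modification \<open>q\<close> of \<open>p\<close> runs through the same stretch of the cycle as \<open>p\<close> until it comes to a
  point of the set \<open>M\<close> where the two may differ.  Thus an orbit of \<open>q\<close> contains each stretch of the
  cycle that it enters.\<close>

lemma orbit_contains_stretch:
  assumes "cyclic_on p S" "a \<in> S"
    and "\<And>z. z \<notin> M \<Longrightarrow> q z = p z"
    and "(p ^^ Suc s) a \<in> orbit q y"
    and "u \<le> funpow_dist1 p a a" "\<And>t. s < t \<Longrightarrow> t < u \<Longrightarrow> t \<notin> funpow_dist p a ` M"
    and "s < t" "t \<le> u"
  shows "(p ^^ t) a \<in> orbit q y"
  using assms(7,8)
proof (induction t)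
  case 0
  then show ?case by simp
next
  case (Suc t)
  show ?case
  proof (cases "t = s")
    case True
    then show ?thesis
      using assms(4) by simp
  next
    case False
    with Suc.prems have t: "s < t" "t < u" by auto
    have "funpow_dist p a ((p ^^ t) a) = t"
      using cyclic_on_funpow_dist_funpow[OF assms(1,2)] t assms(5) by auto
    then have "(p ^^ t) a \<notin> M"
      using assms(6)[OF t] by force
    then have "q ((p ^^ t) a) = (p ^^ Suc t) a"
      using assms(3) by simp
    moreover have "(p ^^ t) a \<in> orbit q y"
      using Suc.IH t by simp
    ultimately show ?thesis
      using orbit.step by metis
  qed
qed

text \<open>An orbit starts with the successor of its base point, so the times run from \<open>1\<close> to the length
  of the cycle, and \<open>a\<close> itself is accounted for at the last of them.\<close>

lemma cyclic_onI_covering: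
  assumes "cyclic_on p S" "a \<in> S" "q ` S \<subseteq> S"
    and "\<And>t. 0 < t \<Longrightarrow> t \<le> funpow_dist1 p a a \<Longrightarrow> (p ^^ t) a \<in> orbit q a"
  shows "cyclic_on q S"
proof (rule cyclic_on_singleI)
  show "a \<in> S" by fact
  have "x \<in> S" if "x \<in> orbit q a" for x
    using that assms(2,3) by (induction rule: orbit.induct) auto
  moreover have "x \<in> orbit q a" if x: "x \<in> S" for x
  proof -
    obtain t where t: "t < funpow_dist1 p a a" "x = (p ^^ t) a"
      using cyclic_on_eq_funpow_image[OF assms(1,2)] x by auto
    have "(p ^^ funpow_dist1 p a a) a = a"
      using assms(1,2) orbit_cyclic_eq3 funpow_dist1_prop by metis
    then show ?thesis
      using t assms(4)[of t] assms(4)[of "funpow_dist1 p a a"] by (cases "t = 0") auto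
  qed
  ultimately show "S = orbit q a" by blast
qed

section \<open>Modifications that keep a single cycle\<close>

text \<open>Cut at its three points, the cycle falls into the stretches \<open>a \<rightarrow> b\<close>, \<open>b \<rightarrow> c\<close>, \<open>c \<rightarrow> a\<close>, each
  without its first and with its last point.  The new permutation leaves \<open>a\<close> into the second
  stretch, from its end \<open>c\<close> goes into the first, and from its end \<open>b\<close> into the third.\<close>

lemma cyclic_on_compose_3_cycle:
  assumes cyc: "cyclic_on p S" and S: "a \<in> S" "b \<in> S" "c \<in> S"
    and "a \<noteq> b" and bc: "funpow_dist p a b < funpow_dist p a c"
  shows "cyclic_on (p \<circ> (transpose a b \<circ> transpose b c)) S"
proof -
  define q where "q = p \<circ> (transpose a b \<circ> transpose b c)"
  define i where "i = funpow_dist p a b"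
  define j where "j = funpow_dist p a c"
  define N where "N = funpow_dist1 p a a"
  have i: "(p ^^ i) a = b" and j: "(p ^^ j) a = c"
    using cyclic_on_funpow_dist[OF cyc] S by (auto simp: i_def j_def)
  have ord: "0 < i" "i < j" "j < N"
    using bc \<open>a \<noteq> b\<close> cyclic_on_funpow_dist_eq_0_iff[OF cyc S(1,2)] cyclic_on_funpow_dist_less[OF cyc S(1,3)]
    unfolding i_def j_def N_def by auto
  have marks: "funpow_dist p a ` {a, b, c} = {0, i, j}"
    by (simp add: i_def j_def funpow_dist_0[OF refl])
  have neq: "a \<noteq> b" "a \<noteq> c" "b \<noteq> c"
    using \<open>a \<noteq> b\<close> bc funpow_dist_0[of a a p] by auto
  have off: "q z = p z" if "z \<notin> {a, b, c}" for z
    using that by (auto simp: q_def transpose_def)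
  have qa: "q a = (p ^^ Suc i) a" and qb: "q b = (p ^^ Suc j) a" and qc: "q c = (p ^^ Suc 0) a"
    using neq by (auto simp: q_def i j transpose_def)
  have into: "q ` S \<subseteq> S"
    unfolding q_def comp_apply
    by (intro image_subsetI cyclic_on_inI[OF cyc]) (use S in \<open>simp add: transpose_def\<close>)
  have stretch: "(p ^^ t) a \<in> orbit q a"
    if "(p ^^ Suc s) a \<in> orbit q a" "u \<le> N" "{s<..<u} \<inter> {0, i, j} = {}" "s < t" "t \<le> u" for s t u
    using orbit_contains_stretch[where M = "{a, b, c}" and q = q, OF cyc S(1) off that(1) _ _ that(4,5)]
      that(2,3) unfolding marks N_def by auto
  have second: "(p ^^ t) a \<in> orbit q a" if "i < t" "t \<le> j" for t
    using stretch[of i j t] orbit.base[of q a] that ord qa by auto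
  have first: "(p ^^ t) a \<in> orbit q a" if "0 < t" "t \<le> i" for t
    using stretch[of 0 i t] orbit.step[OF second[of j]] that ord qc j by auto
  have third: "(p ^^ t) a \<in> orbit q a" if "j < t" "t \<le> N" for t
    using stretch[of j N t] orbit.step[OF first[of i]] that ord qb i by auto
  have "(p ^^ t) a \<in> orbit q a" if "0 < t" "t \<le> N" for t
    using first[of t] second[of t] third[of t] that not_le by blast
  then show ?thesis
    unfolding q_def[symmetric] N_def by (rule cyclic_onI_covering[OF cyc S(1) into])
qed

text \<open>Cut at its four points, the cycle falls into the stretches \<open>a \<rightarrow> b\<close>, \<open>b \<rightarrow> c\<close>, \<open>c \<rightarrow> d\<close>,
  \<open>d \<rightarrow> a\<close>.  The new permutation leaves \<open>a\<close> into the third, from \<open>d\<close> goes into the second, from \<open>c\<close>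
  into the first, and from \<open>b\<close> into the fourth.\<close>

lemma cyclic_on_compose_crossing_transpositions:
  assumes cyc: "cyclic_on p S" and S: "a \<in> S" "b \<in> S" "c \<in> S" "d \<in> S"
    and "a \<noteq> b" and bc: "funpow_dist p a b < funpow_dist p a c"
    and cd: "funpow_dist p a c < funpow_dist p a d"
  shows "cyclic_on (p \<circ> (transpose a c \<circ> transpose b d)) S"
proof -
  define q where "q = p \<circ> (transpose a c \<circ> transpose b d)"
  define i where "i = funpow_dist p a b"
  define j where "j = funpow_dist p a c"
  define k where "k = funpow_dist p a d"
  define N where "N = funpow_dist1 p a a"
  have i: "(p ^^ i) a = b" and j: "(p ^^ j) a = c" and k: "(p ^^ k) a = d"
    using cyclic_on_funpow_dist[OF cyc] S by (auto simp: i_def j_def k_def)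
  have ord: "0 < i" "i < j" "j < k" "k < N"
    using bc cd \<open>a \<noteq> b\<close> cyclic_on_funpow_dist_eq_0_iff[OF cyc S(1,2)] cyclic_on_funpow_dist_less[OF cyc S(1,4)]
    unfolding i_def j_def k_def N_def by auto
  have marks: "funpow_dist p a ` {a, b, c, d} = {0, i, j, k}"
    by (simp add: i_def j_def k_def funpow_dist_0[OF refl])
  have neq: "a \<noteq> b" "a \<noteq> c" "a \<noteq> d" "b \<noteq> c" "b \<noteq> d" "c \<noteq> d"
    using \<open>a \<noteq> b\<close> bc cd funpow_dist_0[of a a p] by auto
  have off: "q z = p z" if "z \<notin> {a, b, c, d}" for z
    using that by (auto simp: q_def transpose_def)
  have qa: "q a = (p ^^ Suc j) a" and qd: "q d = (p ^^ Suc i) a"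
    and qc: "q c = (p ^^ Suc 0) a" and qb: "q b = (p ^^ Suc k) a"
    using neq by (auto simp: q_def i j k transpose_def)
  have into: "q ` S \<subseteq> S"
    unfolding q_def comp_apply
    by (intro image_subsetI cyclic_on_inI[OF cyc]) (use S in \<open>simp add: transpose_def\<close>)
  have stretch: "(p ^^ t) a \<in> orbit q a"
    if "(p ^^ Suc s) a \<in> orbit q a" "u \<le> N" "{s<..<u} \<inter> {0, i, j, k} = {}" "s < t" "t \<le> u" for s t u
    using orbit_contains_stretch[where M = "{a, b, c, d}" and q = q, OF cyc S(1) off that(1) _ _ that(4,5)]
      that(2,3) unfolding marks N_def by auto
  have third: "(p ^^ t) a \<in> orbit q a" if "j < t" "t \<le> k" for t
    using stretch[of j k t] orbit.base[of q a] that ord qa by auto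
  have second: "(p ^^ t) a \<in> orbit q a" if "i < t" "t \<le> j" for t
    using stretch[of i j t] orbit.step[OF third[of k]] that ord qd k by auto
  have first: "(p ^^ t) a \<in> orbit q a" if "0 < t" "t \<le> i" for t
    using stretch[of 0 i t] orbit.step[OF second[of j]] that ord qc j by auto
  have fourth: "(p ^^ t) a \<in> orbit q a" if "k < t" "t \<le> N" for t
    using stretch[of k N t] orbit.step[OF first[of i]] that ord qb i by auto
  have "(p ^^ t) a \<in> orbit q a" if "0 < t" "t \<le> N" for t
    using first[of t] second[of t] third[of t] fourth[of t] that not_le by blast
  then show ?thesis
    unfolding q_def[symmetric] N_def by (rule cyclic_onI_covering[OF cyc S(1) into])
qed

section \<open>Two cycles at once\<close>

lemma transpose_compose_transpose_permutes:
  assumes "a \<in> S" "b \<in> S" "c \<in> S" "d \<in> S"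
  shows "(transpose a b \<circ> transpose c d) permutes S"
  using assms by (intro permutes_compose permutes_swap_id)

text \<open>Let \<open>x 1\<close>, \<open>x 2\<close>, \<open>x 3\<close> be the points after \<open>a\<close> on \<open>s\<close>.  On \<open>g\<close> either some two of them come
  in the same order after \<open>a\<close>, which gives a common 3-cycle, or all three come in reversed order,
  and then the pairs that cross on \<open>s\<close> also cross on \<open>g\<close>.  Four points are needed for a
  crossing: on three, a cycle and its inverse admit no common modification.\<close>

lemma cyclic_on_common_modification:
  assumes s: "cyclic_on s S" and g: "cyclic_on g H" and "S \<subseteq> H" and "card S \<ge> 4"
  shows "\<exists>\<pi>. \<pi> permutes S \<and> \<pi> \<noteq> id \<and> cyclic_on (s \<circ> \<pi>) S \<and> cyclic_on (g \<circ> \<pi>) H"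
proof -
  obtain a where a: "a \<in> S"
    using s by (auto simp: cyclic_on_def)
  define x where "x t = (s ^^ t) a" for t
  have x_in: "x t \<in> S" for t
    using cyclic_on_funpow_in[OF s a] by (simp add: x_def)
  have H: "a \<in> H" "x t \<in> H" for t
    using a x_in \<open>S \<subseteq> H\<close> by auto
  have "card S \<le> funpow_dist1 s a a"
    using cyclic_on_eq_funpow_image[OF s a] by (metis card_atLeastLessThan card_image_le diff_zero finite_atLeastLessThan)
  with \<open>card S \<ge> 4\<close> have x_dist: "funpow_dist s a (x t) = t" if "t < 4" for t
    using cyclic_on_funpow_dist_funpow[OF s a] that by (simp add: x_def)
  have x_neq: "x t \<noteq> x u" if "t < 4" "u < 4" "t \<noteq> u" for t u
    using x_dist that by metis
  have x_neq_a: "a \<noteq> x t" if "0 < t" "t < 4" for t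
    using x_dist[of t] that by (auto simp: funpow_dist_0)
  define r where "r t = funpow_dist g a (x t)" for t
  have r_neq: "r t \<noteq> r u" if "t < 4" "u < 4" "t \<noteq> u" for t u
    using x_neq[OF that] cyclic_on_funpow_dist_inject[OF g H(1) H(2) H(2)] by (simp add: r_def)
  show ?thesis
  proof (cases "\<exists>t u. 0 < t \<and> t < u \<and> u < 4 \<and> r t < r u")
    case True
    then obtain t u where tu: "0 < t" "t < u" "u < 4" "r t < r u" by blast
    let ?\<pi> = "transpose a (x t) \<circ> transpose (x t) (x u)"
    have "?\<pi> permutes S"
      using a x_in by (intro transpose_compose_transpose_permutes)
    moreover have "?\<pi> a \<noteq> a"
      using x_neq_a[of t] x_neq_a[of u] tu by (simp add: transpose_def)
    then have "?\<pi> \<noteq> id" by (metis id_apply)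
    moreover have "cyclic_on (s \<circ> ?\<pi>) S"
      using tu x_dist x_neq_a by (intro cyclic_on_compose_3_cycle[OF s a x_in x_in]) auto
    moreover have "cyclic_on (g \<circ> ?\<pi>) H"
      using tu x_neq_a by (intro cyclic_on_compose_3_cycle[OF g H(1) H(2) H(2)]) (auto simp: r_def)
    ultimately show ?thesis by blast
  next
    case False
    have reversed: "r u < r t" if "0 < t" "t < u" "u < 4" for t u
    proof -
      have "\<not> r t < r u"
        using False that by blast
      with r_neq[of t u] that show ?thesis by simp
    qed
    have rev: "r 3 < r 2" "r 2 < r 1"
      using reversed[of 2 3] reversed[of 1 2] by simp_all
    let ?\<pi> = "transpose a (x 2) \<circ> transpose (x 1) (x 3)"
    have "?\<pi> permutes S"
      using a x_in by (intro transpose_compose_transpose_permutes)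
    moreover have "?\<pi> a \<noteq> a"
      using x_neq_a[of 1] x_neq_a[of 2] x_neq_a[of 3] by (simp add: transpose_def)
    then have "?\<pi> \<noteq> id" by (metis id_apply)
    moreover have "cyclic_on (s \<circ> ?\<pi>) S"
      using x_dist x_neq_a
      by (intro cyclic_on_compose_crossing_transpositions[OF s a x_in x_in x_in]) auto
    moreover
    \<comment> \<open>On \<open>g\<close> the points follow each other as \<open>a\<close>, \<open>x 3\<close>, \<open>x 2\<close>, \<open>x 1\<close>: again first and third,
      second and fourth are exchanged.\<close>
    have "cyclic_on (g \<circ> (transpose a (x 2) \<circ> transpose (x 3) (x 1))) H"
      using rev x_neq_a
      by (intro cyclic_on_compose_crossing_transpositions[OF g H(1) H(2) H(2) H(2)]) (auto simp: r_def)
    then have "cyclic_on (g \<circ> ?\<pi>) H"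
      by (simp add: transpose_commute[of "x 3"])
    ultimately show ?thesis by blast
  qed
qed

section \<open>Rearranging the half edges at a vertex\<close>

lemma replace_cycle_compose:
  assumes "\<pi> permutes v"
  shows "replace_cycle p v (perm_restrict p v \<circ> \<pi>) = p \<circ> \<pi>"
  using permutes_in_image[OF assms] permutes_not_in[OF assms]
  by (auto simp: replace_cycle_def perm_restrict_def fun_eq_iff)

text \<open>Away from \<open>v\<close> every cycle of \<open>p\<close> survives, and on \<open>v\<close> the single old cycle gives way to a
  single new one with the same elements.\<close>

lemma cycles_compose_eq:
  assumes p: "p permutes H" and "finite H" and v: "v \<in> cycles p H"
    and \<pi>: "\<pi> permutes v" and new: "cyclic_on (p \<circ> \<pi>) v"
  shows "cycles (p \<circ> \<pi>) H = cycles p H"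
proof -
  have "orbit (p \<circ> \<pi>) h = orbit p h" if "h \<in> H" for h
  proof (cases "h \<in> v")
    case True
    obtain h' where "v = orbit p h'"
      using v by (auto simp: cycles_def)
    then have "cyclic_on p v"
      using cyclic_on_orbit[OF p \<open>finite H\<close>] by simp
    then show ?thesis
      using orbit_cyclic_eq3[OF _ True] new by metis
  next
    case False
    have cyc: "cyclic_on p (orbit p h)"
      using cyclic_on_orbit[OF p \<open>finite H\<close>] .
    have h: "h \<in> orbit p h"
      using p \<open>finite H\<close> by (metis permutation_self_in_orbit permutes_imp_permutation)
    obtain h' where h': "v = orbit p h'"
      using v by (auto simp: cycles_def)
    have "y \<notin> v" if "y \<in> orbit p h" for y
      using that h h' False cyc cyclic_on_orbit[OF p \<open>finite H\<close>] orbit_cyclic_eq3 by metis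
    then have "\<And>y. y \<in> orbit p h \<Longrightarrow> (p \<circ> \<pi>) y = p y"
      using permutes_not_in[OF \<pi>] by simp
    then show ?thesis
      using orbit_cong[OF h] by metis
  qed
  then show ?thesis by (auto simp: cycles_def)
qed

lemma one_face_num_faces:
  assumes "one_face E"
  shows "num_faces E = 1"
proof -
  let ?H = "half_edges (num_edges E)"
  have cyc: "cyclic_on (gamma E) ?H"
    using assms by (simp add: one_face_def)
  then have "?H \<noteq> {}"
    by (auto simp: cyclic_on_def)
  with orbit_cyclic_eq3[OF cyc] have "cycles (gamma E) ?H = {?H}"
    by (auto simp: cycles_def)
  then show ?thesis by (simp add: num_faces_def)
qed

theorem theorem3p5:
  fixes G :: hgraph and E :: embedding and v :: "nat set"
  assumes "is_graph G"
    and "is_embedding G E"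
    and "one_face E"
    and "v \<in> vertices G"
    and "deg v \<ge> 4"
  shows "\<exists>\<theta>. cyclic_order_on v \<theta> \<and> \<theta> \<noteq> order_at E v \<and>
             is_embedding G (rearrange E v \<theta>) \<and> genus (rearrange E v \<theta>) = genus E"
proof -
  let ?H = "half_edges (num_edges E)"
  have fin: "finite ?H" by (simp add: half_edges_def)
  have emb: "num_edges E = graph_edges G" "alpha E = pairing G" "beta E permutes ?H"
    "cycles (beta E) ?H = vertices G" "gamma E = alpha E \<circ> beta E"
    using assms(2) unfolding is_embedding_def by blast+
  have v: "v \<in> cycles (beta E) ?H"
    using assms(4) emb(4) by simp
  then obtain h where h: "h \<in> ?H" "v = orbit (beta E) h"
    by (auto simp: cycles_def)
  have vH: "v \<subseteq> ?H"
    using permutes_orbit_subset[OF emb(3) h(1)] h(2) by simp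
  have cyc: "cyclic_on (beta E) v"
    using cyclic_on_orbit[OF emb(3) fin] h(2) by simp
  have face: "cyclic_on (gamma E) ?H"
    using assms(3) by (simp add: one_face_def)
  have "card v \<ge> 4"
    using assms(5) by (simp add: deg_def)
  then obtain \<pi>
    where \<pi>: "\<pi> permutes v" "\<pi> \<noteq> id" "cyclic_on (beta E \<circ> \<pi>) v" "cyclic_on (gamma E \<circ> \<pi>) ?H"
    using cyclic_on_common_modification[OF cyc face vH] by blast
  define \<theta> where "\<theta> = order_at E v \<circ> \<pi>"
  have new_beta: "replace_cycle (beta E) v \<theta> = beta E \<circ> \<pi>"
    unfolding \<theta>_def order_at_def by (rule replace_cycle_compose[OF \<pi>(1)])
  have order: "order_at E v permutes v"
  proof -
    have "inj_on (beta E) v"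
      using permutes_inj[OF emb(3)] by (rule inj_on_subset) simp
    moreover have "beta E ` v \<subseteq> v"
      by (intro image_subsetI cyclic_on_inI[OF cyc])
    ultimately have "bij_betw (beta E) v v"
      using finite_subset[OF vH fin] by (simp add: bij_betw_def endo_inj_surj)
    then have "bij_betw (order_at E v) v v"
      by (rule bij_betw_cong[THEN iffD1, rotated]) (simp add: order_at_def perm_restrict_simps)
    then show ?thesis
      by (rule bij_imp_permutes) (simp add: order_at_def perm_restrict_simps)
  qed
  have "\<theta> permutes v"
    unfolding \<theta>_def using \<pi>(1) order by (rule permutes_compose)
  moreover have "cyclic_on \<theta> v"
  proof -
    have "\<theta> x = (beta E \<circ> \<pi>) x" if "x \<in> v" for x
      using that permutes_in_image[OF \<pi>(1)] by (simp add: \<theta>_def order_at_def perm_restrict_simps)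
    then show ?thesis using \<pi>(3) cyclic_cong by metis
  qed
  ultimately have "cyclic_order_on v \<theta>"
    by (simp add: cyclic_order_on_def)
  moreover have "\<theta> \<noteq> order_at E v"
  proof
    assume "\<theta> = order_at E v"
    then have "order_at E v (\<pi> x) = order_at E v x" for x
      by (metis \<theta>_def comp_apply)
    then show False
      using \<pi>(2) permutes_inj[OF order] by (auto simp: fun_eq_iff dest: injD)
  qed
  moreover have emb': "is_embedding G (rearrange E v \<theta>)"
    using emb permutes_compose[OF permutes_subset[OF \<pi>(1) vH] emb(3)]
      cycles_compose_eq[OF emb(3) fin v \<pi>(1,3)]
    by (simp add: is_embedding_def rearrange_def new_beta)
  moreover have "genus (rearrange E v \<theta>) = genus E"
  proof -
    have "one_face (rearrange E v \<theta>)"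
      using \<pi>(4) emb(5) by (simp add: one_face_def rearrange_def new_beta comp_assoc)
    then have "num_faces (rearrange E v \<theta>) = num_faces E"
      using assms(3) by (simp add: one_face_num_faces)
    moreover have "num_vertices (rearrange E v \<theta>) = num_vertices E"
      using assms(2) emb' unfolding num_vertices_def is_embedding_def by metis
    ultimately show ?thesis
      by (simp add: genus_def rearrange_def)
  qed
  ultimately show ?thesis by blast
qed

end
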